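(* Let $m\ge3$, $n\ge m$, and let $G=(V,E)$ be a nontrivial (i.e. $E\neq\emptyset$) $m$-uniform hypergraph with $|V|=n$ and coclique number $\omega(G)$. Then $\omega(G)^{m-1}$ equals the optimal value of the problem $$\max\ \langle\mathcal{X},\mathcal{E}\rangle\quad\text{s.t.}\quad \mathcal{X}_{i_1i_2\cdots i_m}=0\ \text{ whenever } \{i_1,\dots,i_m\}\in E,\quad \langle\mathcal{X},\mathcal{I}\rangle=1,\quad \mathcal{X}\in\mathbb{CP}_{m,n},$$ where $\mathcal{E}$ is the all-ones tensor of order $m$ and dimension $n$.
   Context: An $m$-uniform hypergraph $G=(V,E)$ has vertex set $V=\{1,\dots,n\}$ and edge set $E$ of $m$-element subsets of $V$. A coclique is a vertex set none of whose $m$-element subsets is an edge; $\omega(G)$ is the maximum cardinality of a coclique. $\mathcal{I}$ is the identity tensor of order $m$, dimension $n$ ($\mathcal{I}_{i_1\cdots i_m}=1$ if $i_1=\cdots=i_m$, $0$ otherwise). $\langle\mathcal{A},\mathcal{B}\rangle=\sum_{i_1,\dots,i_m}a_{i_1\cdots i_m}b_{i_1\cdots i_m}$. $\mathbb{CP}_{m,n}$ is the cone of completely positive tensors: tensors of the form $\sum_{k=1}^r \mathbf{x}_k^{\circ m}$ with $\mathbf{x}_k\in\mathbb{R}^n_+$, where $(\mathbf{x}^{\circ m})_{i_1\cdots i_m}=x_{i_1}\cdots x_{i_m}$. *)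

theory Defs
  imports Complex_Main "HOL-Library.FuncSet"
begin

text \<open>A tensor of order \<open>m\<close> and dimension \<open>n\<close> is a function on the index lists
  \<open>[i\<^sub>1, \<dots>, i\<^sub>m]\<close> with entries in \<open>{1..n}\<close>; concrete tensors are set to
  \<open>undefined\<close> off this set (as in \<^const>\<open>restrict\<close>), so that equality of tensors is
  equality of functions.\<close>

type_synonym tensor = "nat list \<Rightarrow> real"

definition indices :: "nat \<Rightarrow> nat \<Rightarrow> nat list set" where
  "indices m n = {is. length is = m \<and> set is \<subseteq> {1..n}}"

definition tensor_inner :: "nat \<Rightarrow> nat \<Rightarrow> tensor \<Rightarrow> tensor \<Rightarrow> real" where
  "tensor_inner m n A B = (\<Sum>is\<in>indices m n. A is * B is)"

definition identity_tensor :: "nat \<Rightarrow> nat \<Rightarrow> tensor" where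
  "identity_tensor m n =
     (\<lambda>is\<in>indices m n. if \<forall>i\<in>set is. \<forall>j\<in>set is. i = j then 1 else 0)"

definition all_ones_tensor :: "nat \<Rightarrow> nat \<Rightarrow> tensor" where
  "all_ones_tensor m n = (\<lambda>is\<in>indices m n. 1)"

text \<open>Only the values at \<open>1, \<dots>, n\<close> of a vector in \<open>\<real>\<^sup>n\<close> are relevant.\<close>

definition nonneg_vectors :: "nat \<Rightarrow> (nat \<Rightarrow> real) set" where
  "nonneg_vectors n = {x. \<forall>i\<in>{1..n}. 0 \<le> x i}"

definition tensor_power :: "nat \<Rightarrow> nat \<Rightarrow> (nat \<Rightarrow> real) \<Rightarrow> tensor" where
  "tensor_power m n x = (\<lambda>is\<in>indices m n. \<Prod>j<m. x (is ! j))"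

definition CP :: "nat \<Rightarrow> nat \<Rightarrow> tensor set" where
  "CP m n = {X. \<exists>(r::nat) x. (\<forall>k\<in>{1..r}. x k \<in> nonneg_vectors n) \<and>
     X = (\<lambda>is\<in>indices m n. \<Sum>k=1..r. tensor_power m n (x k) is)}"

text \<open>Hypergraphs have vertex set \<open>{1..n}\<close> and are given by their edge set \<open>E\<close>.\<close>

definition uniform_hypergraph :: "nat \<Rightarrow> nat \<Rightarrow> nat set set \<Rightarrow> bool" where
  "uniform_hypergraph m n E \<longleftrightarrow> (\<forall>e\<in>E. e \<subseteq> {1..n} \<and> card e = m)"

definition coclique :: "nat \<Rightarrow> nat \<Rightarrow> nat set set \<Rightarrow> nat set \<Rightarrow> bool" where
  "coclique m n E S \<longleftrightarrow> S \<subseteq> {1..n} \<and> (\<forall>T. T \<subseteq> S \<and> card T = m \<longrightarrow> T \<notin> E)"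

definition coclique_number :: "nat \<Rightarrow> nat \<Rightarrow> nat set set \<Rightarrow> nat" where
  "coclique_number m n E = Max {card S |S. coclique m n E S}"

definition feasible :: "nat \<Rightarrow> nat \<Rightarrow> nat set set \<Rightarrow> tensor set" where
  "feasible m n E = {X \<in> CP m n.
     (\<forall>is\<in>indices m n. set is \<in> E \<longrightarrow> X is = 0) \<and>
     tensor_inner m n X (identity_tensor m n) = 1}"

text \<open>The optimal value of a maximisation problem, including that it is attained.\<close>

definition is_max_value :: "('a \<Rightarrow> real) \<Rightarrow> 'a set \<Rightarrow> real \<Rightarrow> bool" where
  "is_max_value f S v \<longleftrightarrow> (\<exists>x\<in>S. f x = v) \<and> (\<forall>x\<in>S. f x \<le> v)"

end

theory Submission
  imports Defs "HOL-Analysis.Convex"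
begin

text \<open>For \<open>\<X> = \<Sum>\<^sub>k x\<^sub>k\<^sup>m\<close> (tensor powers) with \<open>x\<^sub>k \<ge> 0\<close>, the objective is \<open>\<Sum>\<^sub>k (\<Sum>\<^sub>i x\<^sub>k(i))\<^sup>m\<close> and the
  normalisation says \<open>\<Sum>\<^sub>k \<Sum>\<^sub>i x\<^sub>k(i)\<^sup>m = 1\<close>. No cancellation can occur among
  nonnegative terms, so the support of each \<open>x\<^sub>k\<close> is a coclique, and the power mean inequality
  on that support gives the upper bound. Equality holds for the suitably scaled indicator vector
  of a maximum coclique.\<close>

lemma finite_indices [simp]: "finite (indices m n)"
  using finite_lists_length_eq [of "{1..n}" m] by (simp add: indices_def conj_commute)

lemma indices_Suc: "indices (Suc m) n = (\<lambda>(i, is). i # is) ` ({1..n} \<times> indices m n)"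
  by (force simp: indices_def length_Suc_conv)

text \<open>Distributivity: expanding the power gives one product for each choice of an index in
  every factor. The induction splits off the first index of the list.\<close>

lemma sum_indices_prod:
  "(\<Sum>is\<in>indices m n. \<Prod>j<m. x (is ! j)) = (\<Sum>i=1..n. x i :: 'a :: comm_semiring_1) ^ m"
proof (induction m)
  case 0
  then show ?case by (simp add: indices_def cong: conj_cong)
next
  case (Suc m)
  have "(\<Sum>is\<in>indices (Suc m) n. \<Prod>j<Suc m. x (is ! j)) =
      (\<Sum>(i, is)\<in>{1..n} \<times> indices m n. x i * (\<Prod>j<m. x (is ! j)))"
    unfolding indices_Suc
    by (subst sum.reindex)
      (auto simp: inj_on_def prod.lessThan_Suc_shift intro!: sum.cong simp del: prod.lessThan_Suc)
  also have "\<dots> = (\<Sum>i=1..n. x i) * (\<Sum>is\<in>indices m n. \<Prod>j<m. x (is ! j))"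
    by (simp add: sum_product sum.cartesian_product)
  finally show ?case by (simp add: Suc.IH)
qed

lemma inner_all_ones_tensor_power:
  "tensor_inner m n (tensor_power m n x) (all_ones_tensor m n) = (\<Sum>i=1..n. x i) ^ m"
  by (simp add: tensor_inner_def tensor_power_def all_ones_tensor_def sum_indices_prod)

text \<open>Only constant index lists survive, and there is one for each \<open>i\<close>. The
  assumption \<open>m > 0\<close> keeps these lists distinct: for \<open>m = 0\<close> they all
  collapse to the empty list.\<close>

lemma inner_identity_tensor_power:
  assumes "m > 0"
  shows "tensor_inner m n (tensor_power m n x) (identity_tensor m n) = (\<Sum>i=1..n. x i ^ m)"
proof -
  let ?D = "{is \<in> indices m n. \<forall>i\<in>set is. \<forall>j\<in>set is. i = j}"
  have D: "?D = replicate m ` {1..n}"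
  proof (intro equalityI subsetI)
    fix xs assume xs: "xs \<in> ?D"
    then have len: "length xs = m" and sub: "set xs \<subseteq> {1..n}" by (auto simp: indices_def)
    have "hd xs \<in> set xs" using len assms by (cases xs) auto
    moreover from this have "xs = replicate m (hd xs)"
      using xs len by (auto simp: replicate_eqI)
    ultimately show "xs \<in> replicate m ` {1..n}" using sub by blast
  qed (auto simp: indices_def)
  have "tensor_inner m n (tensor_power m n x) (identity_tensor m n) =
      (\<Sum>is\<in>?D. \<Prod>j<m. x (is ! j))"
    unfolding tensor_inner_def
    by (rule sum.mono_neutral_cong_right)
      (auto simp: tensor_power_def identity_tensor_def)
  also have "\<dots> = (\<Sum>i=1..n. x i ^ m)"
    unfolding D using assms by (subst sum.reindex) (auto simp: inj_on_def)
  finally show ?thesis .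
qed

text \<open>Linearity in the form in which \<open>CP\<close> presents its members; it reduces
  objective and normalisation to single tensor powers.\<close>

lemma tensor_inner_sum:
  "tensor_inner m n (\<lambda>is\<in>indices m n. \<Sum>k\<in>K. A k is) B = (\<Sum>k\<in>K. tensor_inner m n (A k) B)"
  unfolding tensor_inner_def
  by (subst sum.swap) (simp add: sum_distrib_right)

lemma tensor_power_nonneg:
  assumes "x \<in> nonneg_vectors n" "is \<in> indices m n"
  shows "tensor_power m n x is \<ge> 0"
  using assms nth_mem by (fastforce simp: tensor_power_def nonneg_vectors_def indices_def
    intro!: prod_nonneg)

text \<open>Power mean inequality: Jensen for \<open>t ^ m\<close> on the nonnegative half-line with
  equal weights \<open>1 / card S\<close>, cleared of denominators.\<close>

lemma sum_power_le_card_power_mult_sum: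
  fixes x :: "'a \<Rightarrow> real"
  assumes "finite S" "\<And>i. i \<in> S \<Longrightarrow> x i \<ge> 0" "m > 0"
  shows "(\<Sum>i\<in>S. x i) ^ m \<le> real (card S) ^ (m - 1) * (\<Sum>i\<in>S. x i ^ m)"
proof (cases "S = {}")
  case True
  then show ?thesis using assms by (simp add: power_0_left)
next
  case False
  have cvx: "convex_on {0..} (\<lambda>x::real. x ^ m)"
  \<comment> \<open>Even powers are convex on the whole line, odd powers in general only on the
    nonnegative half-line, so the two parities are treated apart.\<close>
  proof (cases "even m")
    case True
    then show ?thesis using convex_on_subset [OF convex_power_even] by auto
  qed (use convex_power_odd in auto)
  define c where "c = real (card S)"
  have c: "c > 0" using False assms by (simp add: c_def card_gt_0_iff)
  have "(\<Sum>i\<in>S. (1 / c) *\<^sub>R x i) ^ m \<le> (\<Sum>i\<in>S. (1 / c) * x i ^ m)"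
    using assms False c by (intro convex_on_sum [OF _ _ cvx]) (auto simp: c_def)
  then have "(\<Sum>i\<in>S. x i) ^ m / c ^ m \<le> (\<Sum>i\<in>S. x i ^ m) / c"
    by (simp add: power_divide flip: sum_divide_distrib)
  moreover have "c ^ m = c * c ^ (m - 1)" using assms by (simp add: power_eq_if)
  ultimately show ?thesis using c by (simp add: c_def [symmetric] field_simps)
qed

lemma finite_coclique_cards: "finite {card S |S. coclique m n E S}"
  by (rule finite_subset [of _ "card ` Pow {1..n}"]) (auto simp: coclique_def)

lemma coclique_card_le: "coclique m n E S \<Longrightarrow> card S \<le> coclique_number m n E"
  unfolding coclique_number_def by (intro Max_ge finite_coclique_cards) auto

lemma coclique_number_attained:
  assumes "m > 0"
  obtains S where "coclique m n E S" "card S = coclique_number m n E"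
proof -
  \<comment> \<open>The empty set makes the maximum range over a nonempty set; it is a coclique
    because \<open>m > 0\<close> excludes the empty edge.\<close>
  have "coclique m n E {}" using assms by (auto simp: coclique_def)
  then have "coclique_number m n E \<in> {card S |S. coclique m n E S}"
    unfolding coclique_number_def by (intro Max_in finite_coclique_cards) auto
  then show ?thesis using that by auto
qed

lemma coclique_number_pos:
  assumes "m \<ge> 2" "n \<ge> 1"
  shows "coclique_number m n E > 0"
proof -
  have "coclique m n E {1}"
    unfolding coclique_def
  proof (intro conjI allI impI)
    fix T :: "nat set" assume "T \<subseteq> {1} \<and> card T = m"
    then show "T \<notin> E" using card_mono [of "{1}" T] assms by auto
  qed (use assms in auto)
  from coclique_card_le [OF this] show ?thesis by simp
qed

text \<open>An edge inside the support, listed without repetition, would be an index at which the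
  entry is a product of nonzero numbers.\<close>

lemma support_coclique:
  assumes E: "uniform_hypergraph m n E"
    and zero: "\<And>is. is \<in> indices m n \<Longrightarrow> set is \<in> E \<Longrightarrow> tensor_power m n x is = 0"
  shows "coclique m n E {i \<in> {1..n}. x i \<noteq> 0}"
  unfolding coclique_def
proof (intro conjI allI impI notI)
  fix T assume T: "T \<subseteq> {i \<in> {1..n}. x i \<noteq> 0} \<and> card T = m" "T \<in> E"
  then have "finite T" using finite_subset [of T "{1..n}"] by blast
  then obtain xs where xs: "set xs = T" "distinct xs" using finite_distinct_list by blast
  then have idx: "xs \<in> indices m n"
    using T distinct_card [of xs] by (auto simp: indices_def)
  with zero xs T have "(\<Prod>j<m. x (xs ! j)) = 0" by (simp add: tensor_power_def)
  then obtain j where "j < m" "x (xs ! j) = 0" by auto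
  moreover have "xs ! j \<in> T" using idx xs \<open>j < m\<close> by (auto simp: indices_def)
  ultimately show False using T by auto
qed auto

lemma power_sum_le_coclique_number:
  assumes "m > 0" "x \<in> nonneg_vectors n" "coclique m n E {i \<in> {1..n}. x i \<noteq> 0}"
  shows "(\<Sum>i=1..n. x i) ^ m \<le> real (coclique_number m n E) ^ (m - 1) * (\<Sum>i=1..n. x i ^ m)"
proof -
  let ?S = "{i \<in> {1..n}. x i \<noteq> 0}"
  have nn: "x i \<ge> 0" if "i \<in> ?S" for i using assms(2) that by (auto simp: nonneg_vectors_def)
  have "(\<Sum>i=1..n. x i) ^ m = (\<Sum>i\<in>?S. x i) ^ m"
    by (rule arg_cong [where f = "\<lambda>t. t ^ m"], rule sum.mono_neutral_right) auto
  also have "\<dots> \<le> real (card ?S) ^ (m - 1) * (\<Sum>i\<in>?S. x i ^ m)"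
    using nn assms(1) by (intro sum_power_le_card_power_mult_sum) auto
  also have "\<dots> \<le> real (coclique_number m n E) ^ (m - 1) * (\<Sum>i\<in>?S. x i ^ m)"
    using coclique_card_le [OF assms(3)] nn
    by (intro mult_right_mono power_mono sum_nonneg) auto
  \<comment> \<open>Since \<open>m > 0\<close>, \<open>0 ^ m = 0\<close>, so vertices outside the
    support add nothing.\<close>
  also have "(\<Sum>i\<in>?S. x i ^ m) = (\<Sum>i=1..n. x i ^ m)"
    using assms(1) by (intro sum.mono_neutral_left) auto
  finally show ?thesis .
qed

lemma feasible_upper_bound:
  assumes m: "m > 0" and E: "uniform_hypergraph m n E" and X: "X \<in> feasible m n E"
  shows "tensor_inner m n X (all_ones_tensor m n) \<le> real (coclique_number m n E) ^ (m - 1)"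
proof -
  obtain r :: nat and x where nn: "\<And>k. k \<in> {1..r} \<Longrightarrow> x k \<in> nonneg_vectors n"
    and Xeq: "X = (\<lambda>is\<in>indices m n. \<Sum>k=1..r. tensor_power m n (x k) is)"
    using X unfolding feasible_def CP_def by blast
  let ?w = "real (coclique_number m n E)"
  have "coclique m n E {i \<in> {1..n}. x k i \<noteq> 0}" if k: "k \<in> {1..r}" for k
  proof (rule support_coclique [OF E])
    fix xs assume xs: "xs \<in> indices m n" "set xs \<in> E"
    then have "(\<Sum>k=1..r. tensor_power m n (x k) xs) = 0"
      using X by (auto simp: feasible_def Xeq)
    then show "tensor_power m n (x k) xs = 0"
      using k xs nn tensor_power_nonneg by (subst (asm) sum_nonneg_eq_0_iff) auto
  qed
  \<comment> \<open>The factor \<open>?w ^ (m - 1)\<close> is the same for all \<open>k\<close>, so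
    the bounds add up and the normalisation removes the remaining sum.\<close>
  then have "(\<Sum>k=1..r. (\<Sum>i=1..n. x k i) ^ m) \<le> (\<Sum>k=1..r. ?w ^ (m - 1) * (\<Sum>i=1..n. x k i ^ m))"
    using nn m by (intro sum_mono power_sum_le_coclique_number) auto
  moreover have "(\<Sum>k=1..r. \<Sum>i=1..n. x k i ^ m) = 1"
    using X m by (simp add: feasible_def Xeq tensor_inner_sum inner_identity_tensor_power)
  ultimately show ?thesis
    by (simp add: Xeq tensor_inner_sum inner_all_ones_tensor_power flip: sum_distrib_left)
qed

lemma coclique_feasible:
  assumes m: "m > 0" and E: "uniform_hypergraph m n E"
    and S: "coclique m n E S" "S \<noteq> {}"
  obtains X where "X \<in> feasible m n E"
    "tensor_inner m n X (all_ones_tensor m n) = real (card S) ^ (m - 1)"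
proof -
  define c where "c = real (card S)"
  \<comment> \<open>With this scaling the \<open>m\<close>-th powers of the entries sum to
    \<open>c * (1 / c) = 1\<close>, and the \<open>m\<close>-th power of their sum is
    \<open>c ^ m * (1 / c) = c ^ (m - 1)\<close>.\<close>
  define x where "x = (\<lambda>i. if i \<in> S then root m (1 / c) else 0)"
  define X where "X = tensor_power m n x"
  have sub: "S \<subseteq> {1..n}" using S by (auto simp: coclique_def)
  then have fin: "finite S" by (rule finite_subset) simp
  then have c: "c > 0" using S by (simp add: c_def card_gt_0_iff)
  have root: "root m (1 / c) ^ m = 1 / c" using m c by simp
  \<comment> \<open>Used twice: with \<open>t ^ m\<close> for the normalisation and with the
    identity for the objective.\<close>
  have sum: "(\<Sum>i=1..n. f (x i)) = c * f (root m (1 / c))" if "f 0 = 0" for f :: "real \<Rightarrow> real"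
  proof -
    have "(\<Sum>i=1..n. f (x i)) = (\<Sum>i\<in>S. f (x i))"
      using sub that by (intro sum.mono_neutral_right) (auto simp: x_def)
    then show ?thesis by (simp add: x_def c_def)
  qed
  have "X \<in> CP m n"
    unfolding CP_def
  proof (intro CollectI exI conjI)
    show "X = (\<lambda>is\<in>indices m n. \<Sum>k=1..(1::nat). tensor_power m n ((\<lambda>_. x) k) is)"
      by (auto simp: X_def tensor_power_def)
  qed (use c m in \<open>auto simp: nonneg_vectors_def x_def\<close>)
  moreover have "X xs = 0" if xs: "xs \<in> indices m n" "set xs \<in> E" for xs
  proof -
    have "card (set xs) = m" using E xs by (auto simp: uniform_hypergraph_def)
    \<comment> \<open>An edge leaves the coclique, and an index outside \<open>S\<close> contributes
      a zero factor to the entry.\<close>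
    then have "\<not> set xs \<subseteq> S" using S xs by (auto simp: coclique_def)
    then obtain i where "i \<in> set xs" "i \<notin> S" by blast
    then obtain j where "j < m" "xs ! j \<notin> S"
      using xs by (auto simp: indices_def in_set_conv_nth)
    then show ?thesis using xs by (auto simp: X_def tensor_power_def x_def)
  qed
  moreover have "tensor_inner m n X (identity_tensor m n) = 1"
    using sum [of "\<lambda>t. t ^ m"] m c root by (simp add: X_def inner_identity_tensor_power)
  ultimately have "X \<in> feasible m n E" by (simp add: feasible_def)
  moreover have "c ^ m = c * c ^ (m - 1)" using m by (simp add: power_eq_if)
  then have "tensor_inner m n X (all_ones_tensor m n) = real (card S) ^ (m - 1)"
    using sum [of "\<lambda>t. t"] c root
    by (simp add: X_def inner_all_ones_tensor_power power_mult_distrib flip: c_def)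
  ultimately show ?thesis by (rule that)
qed

theorem theorem5p1:
  fixes m n :: nat and E :: "nat set set"
  assumes "m \<ge> 3" and "n \<ge> m"
    and "uniform_hypergraph m n E" and "E \<noteq> {}"
  shows "is_max_value (\<lambda>X. tensor_inner m n X (all_ones_tensor m n)) (feasible m n E)
           (real (coclique_number m n E) ^ (m - 1))"
proof -
  obtain S where S: "coclique m n E S" "card S = coclique_number m n E"
    using assms by (auto intro: coclique_number_attained [of m n E])
  \<comment> \<open>The scaling by \<open>1 / card S\<close> requires a nonempty coclique;
    singletons are cocliques because \<open>m \<ge> 2\<close>.\<close>
  moreover have "S \<noteq> {}" using S coclique_number_pos [of m n E] assms by auto
  ultimately obtain X where "X \<in> feasible m n E"
    "tensor_inner m n X (all_ones_tensor m n) = real (coclique_number m n E) ^ (m - 1)"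
    using coclique_feasible [of m n E S] assms by auto
  then show ?thesis
    using feasible_upper_bound [of m n E] assms unfolding is_max_value_def by auto
qed

end
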